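(* Let $L=\begin{pmatrix} a&b\\ c&d\end{pmatrix}$ be an invertible matrix with integer entries (i.e. $a,b,c,d\in\mathbb{Z}$ and $ad-bc\neq 0$), let $\tau$ be a nonzero real number with $\tau\neq\pm1$, and let $$\mathcal{C}_L=\{(z,w)\in(\mathbb{C}^* )^2 : g(z,w)=0\},\qquad g(z,w)=1+\tau z^aw^c+\tau z^bw^d+z^{a+b}w^{c+d}.$$ Then the amoeba $\mathscr{A}_{\mathcal{C}_L}=\mathrm{Log}(\mathcal{C}_L)$ contains the origin $\mathcal{O}\in\mathbb{R}^2$, and the number $s$ of connected components of the inverse image $\mathcal{C}_L\cap\mathrm{Log}^{-1}(\mathcal{O})$ of the origin under the logarithmic map restricted to $\mathcal{C}_L$ is as follows. (i) If $|\tau|>1$, then $s$ is equal to the integer length of the diagonal $\left[\begin{pmatrix} a\\ c\end{pmatrix},\begin{pmatrix} b\\ d\end{pmatrix}\right]$ of the Newton polygon of $g$, and $\mathcal{C}_L\cap\mathrm{Log}^{-1}(\mathcal{O})$ is a link of $s$ torus knots. Moreover, $$s=\mathrm{intl}_{\mathbb{Z}}\left(\left[\begin{pmatrix} a\\ c\end{pmatrix},\begin{pmatrix} b\\ d\end{pmatrix}\right]\right)=|\gcd(b-a,d-c)|.$$ (ii) If $0<|\tau|<1$, then $s$ is equal to the integer length of the second diagonal $\left[\begin{pmatrix} 0\\ 0\end{pmatrix},\begin{pmatrix} a+b\\ c+d\end{pmatrix}\right]$ of the Newton polygon of $g$, and $\mathcal{C}_L\cap\mathrm{Log}^{-1}(\mathcal{O})$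 is a link of $s$ torus knots, where $$s=\mathrm{intl}_{\mathbb{Z}}\left(\left[\begin{pmatrix} a+b\\ 0\end{pmatrix},\begin{pmatrix} 0\\ c+d\end{pmatrix}\right]\right)=|\gcd(b+a,c+d)|.$$
   Context: $\mathrm{Log}:(\mathbb{C}^* )^2\to\mathbb{R}^2$ is the map $(z,w)\mapsto(\log|z|,\log|w|)$; the amoeba of a subset of $(\mathbb{C}^* )^2$ is its image under $\mathrm{Log}$. The fiber over the origin is the real torus $\mathrm{Log}^{-1}(\mathcal{O})=S^1\times S^1\subset(\mathbb{C}^* )^2$. The Newton polygon of a (Laurent) polynomial is the convex hull in $\mathbb{R}^2$ of the set of exponent vectors of its nonzero monomials; for $g$ it is the parallelogram with vertices $(0,0),(a,c),(b,d),(a+b,c+d)$. For a segment $I=[A,B]\subset\mathbb{R}^n$ with endpoints $A,B\in\mathbb{Z}^n$, the integer length is $\mathrm{intl}_{\mathbb{Z}}(I)=\#(\mathbb{Z}^n\cap I)-1$. A knot is a subset of $\mathbb{R}^3$ homeomorphic to a circle; a link is a subset of $\mathbb{R}^3$ homeomorphic to a disjoint union of circles. A torus knot (resp. torus link) is a knot (resp. link) lying on an unknotted 2-dimensional real torus embedded in $\mathbb{R}^3$; the trivial knot is allowed as a torus knot. Here the torus $\mathrm{Log}^{-1}(\mathcal{O})=S^1\times S^1$ is regarded as such an unknotted torus in $\mathbb{R}^3$. *)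

theory Defs
  imports "HOL-Analysis.Analysis" "HOL-Library.Poly_Mapping"
begin

section \<open>Amoebas in dimension two\<close>

definition Cstar2 :: "(complex \<times> complex) set" where
  "Cstar2 = {(z, w). z \<noteq> 0 \<and> w \<noteq> 0}"

definition Log :: "complex \<times> complex \<Rightarrow> real ^ 2" where
  "Log p = vector [ln (cmod (fst p)), ln (cmod (snd p))]"

definition amoeba :: "(complex \<times> complex) set \<Rightarrow> (real ^ 2) set" where
  "amoeba S = Log ` S"

text \<open>The restriction to \<^const>\<open>Cstar2\<close> matters: since \<open>ln 0 = 0\<close> in HOL, the total
  function \<^const>\<open>Log\<close> also vanishes at some points on the coordinate axes.\<close>

definition log_fiber :: "real ^ 2 \<Rightarrow> (complex \<times> complex) set" where
  "log_fiber x = {p \<in> Cstar2. Log p = x}"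

lemma log_fiber_0: "log_fiber 0 = sphere 0 1 \<times> sphere 0 1"
  by (auto simp: log_fiber_def Cstar2_def Log_def vec_eq_iff forall_2)

section \<open>Laurent polynomials and Newton polygons\<close>

text \<open>A Laurent polynomial is a finitely supported family of coefficients, indexed by
  the exponent vectors \<open>(i, j)\<close> of the monomials \<open>z\<^sup>i w\<^sup>j\<close>.\<close>

type_synonym laurent2 = "(int \<times> int, complex) poly_mapping"

definition laurent_eval :: "laurent2 \<Rightarrow> complex \<times> complex \<Rightarrow> complex" where
  "laurent_eval p x = (\<Sum>k\<in>Poly_Mapping.keys p.
      Poly_Mapping.lookup p k * fst x powi fst k * snd x powi snd k)"

definition zero_locus :: "laurent2 \<Rightarrow> (complex \<times> complex) set" where
  "zero_locus p = {x \<in> Cstar2. laurent_eval p x = 0}"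

definition lattice_point :: "int \<Rightarrow> int \<Rightarrow> real ^ 2" where
  "lattice_point i j = vector [of_int i, of_int j]"

definition newton_polygon :: "laurent2 \<Rightarrow> (real ^ 2) set" where
  "newton_polygon p = convex hull ((\<lambda>(i, j). lattice_point i j) ` Poly_Mapping.keys p)"

definition is_diagonal :: "(real ^ 2) set \<Rightarrow> real ^ 2 \<Rightarrow> real ^ 2 \<Rightarrow> bool" where
  "is_diagonal P A B \<longleftrightarrow> A extreme_point_of P \<and> B extreme_point_of P \<and> A \<noteq> B \<and>
     \<not> closed_segment A B edge_of P"

definition integer_length :: "real ^ 'n \<Rightarrow> real ^ 'n \<Rightarrow> nat" where
  "integer_length A B = card ({x. \<forall>i. x $ i \<in> \<int>} \<inter> closed_segment A B) - 1"

definition g_poly :: "int \<Rightarrow> int \<Rightarrow> int \<Rightarrow> int \<Rightarrow> real \<Rightarrow> laurent2" where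
  "g_poly a b c d \<tau> =
     Poly_Mapping.single (0, 0) 1 + Poly_Mapping.single (a, c) (complex_of_real \<tau>) +
     Poly_Mapping.single (b, d) (complex_of_real \<tau>) + Poly_Mapping.single (a + b, c + d) 1"

definition curve_L :: "int \<Rightarrow> int \<Rightarrow> int \<Rightarrow> int \<Rightarrow> real \<Rightarrow> (complex \<times> complex) set" where
  "curve_L a b c d \<tau> = zero_locus (g_poly a b c d \<tau>)"

lemma laurent_eval_superset:
  assumes "finite K" "Poly_Mapping.keys p \<subseteq> K"
  shows "laurent_eval p x =
    (\<Sum>k\<in>K. Poly_Mapping.lookup p k * fst x powi fst k * snd x powi snd k)"
  unfolding laurent_eval_def
  by (rule sum.mono_neutral_left) (use assms in \<open>auto simp: in_keys_iff\<close>)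

lemma laurent_eval_add: "laurent_eval (p + q) x = laurent_eval p x + laurent_eval q x"
proof -
  let ?K = "Poly_Mapping.keys p \<union> Poly_Mapping.keys q"
  have "laurent_eval r x = (\<Sum>k\<in>?K. Poly_Mapping.lookup r k * fst x powi fst k * snd x powi snd k)"
    if "Poly_Mapping.keys r \<subseteq> ?K" for r
    using that by (intro laurent_eval_superset) auto
  from this[of p] this[of q] this[of "p + q"] show ?thesis
    using keys_add[of p q] by (simp add: lookup_add algebra_simps sum.distrib)
qed

lemma laurent_eval_single:
  "laurent_eval (Poly_Mapping.single k c) x = c * fst x powi fst k * snd x powi snd k"
  by (simp add: laurent_eval_def)

lemma curve_L_eq:
  "curve_L a b c d \<tau> = {(z, w). z \<noteq> 0 \<and> w \<noteq> 0 \<and>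
     1 + of_real \<tau> * z powi a * w powi c + of_real \<tau> * z powi b * w powi d
       + z powi (a + b) * w powi (c + d) = 0}"
  by (auto simp: curve_L_def zero_locus_def g_poly_def laurent_eval_add laurent_eval_single
      Cstar2_def)

lemma newton_polygon_g_poly:
  assumes "a * d - b * c \<noteq> 0" "\<tau> \<noteq> 0"
  shows "newton_polygon (g_poly a b c d \<tau>) = convex hull
    {0, lattice_point a c, lattice_point b d, lattice_point (a + b) (c + d)}"
proof -
  have ne: "(0, 0) \<noteq> (a, c)" "(0, 0) \<noteq> (b, d)" "(a, c) \<noteq> (b, d)"
    "(a, c) \<noteq> (a + b, c + d)" "(b, d) \<noteq> (a + b, c + d)"
    using assms by (auto simp: algebra_simps)
  have "(0, 0) \<noteq> (a + b, c + d)"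
  proof
    assume "(0, 0) = (a + b, c + d)"
    then have "b = - a" "d = - c" by auto
    with assms show False by simp
  qed
  with ne have "Poly_Mapping.keys (g_poly a b c d \<tau>) = {(0, 0), (a, c), (b, d), (a + b, c + d)}"
    using assms(2)
    by (auto simp: set_eq_iff in_keys_iff g_poly_def lookup_add lookup_single when_def)
  moreover have "lattice_point 0 0 = 0"
    by (simp add: lattice_point_def vec_eq_iff forall_2)
  ultimately show ?thesis
    by (simp add: newton_polygon_def)
qed

section \<open>Knots and links in three-space\<close>

definition is_knot :: "(real ^ 3) set \<Rightarrow> bool" where
  "is_knot K \<longleftrightarrow> K homeomorphic sphere (0 :: complex) 1"

definition is_link :: "(real ^ 3) set \<Rightarrow> bool" where
  "is_link S \<longleftrightarrow> (\<exists>n :: nat. top_of_set S homeomorphic_space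
     sum_topology (\<lambda>_. top_of_set (sphere (0 :: complex) 1)) {..<n})"

text \<open>Parametrisation of the torus of revolution with radii 2 and 1 around the third axis.\<close>

definition standard_torus_map :: "complex \<times> complex \<Rightarrow> real ^ 3" where
  "standard_torus_map p =
     vector [(2 + Re (snd p)) * Re (fst p), (2 + Re (snd p)) * Im (fst p), Im (snd p)]"

definition standard_torus :: "(real ^ 3) set" where
  "standard_torus = standard_torus_map ` (sphere 0 1 \<times> sphere 0 1)"

definition ambient_isotopic :: "(real ^ 3) set \<Rightarrow> (real ^ 3) set \<Rightarrow> bool" where
  "ambient_isotopic S T \<longleftrightarrow> (\<exists>H :: real \<times> (real ^ 3) \<Rightarrow> real ^ 3.
     continuous_on ({0..1} \<times> UNIV) H \<and>
     (\<forall>t\<in>{0..1}. \<exists>h. homeomorphism UNIV UNIV (\<lambda>x. H (t, x)) h) \<and>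
     (\<forall>x. H (0, x) = x) \<and> (\<lambda>x. H (1, x)) ` S = T)"

definition unknotted_torus :: "(real ^ 3) set \<Rightarrow> bool" where
  "unknotted_torus T \<longleftrightarrow> ambient_isotopic standard_torus T"

definition torus_knot :: "(real ^ 3) set \<Rightarrow> bool" where
  "torus_knot K \<longleftrightarrow> is_knot K \<and> (\<exists>T. unknotted_torus T \<and> K \<subseteq> T)"

definition torus_link :: "(real ^ 3) set \<Rightarrow> bool" where
  "torus_link S \<longleftrightarrow> is_link S \<and> (\<exists>T. unknotted_torus T \<and> S \<subseteq> T)"

definition link_of_torus_knots :: "nat \<Rightarrow> (real ^ 3) set \<Rightarrow> bool" where
  "link_of_torus_knots s S \<longleftrightarrow> torus_link S \<and>
     finite (components S) \<and> card (components S) = s \<and> (\<forall>K\<in>components S. torus_knot K)"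

text \<open>An identification of the torus \<open>log_fiber 0\<close> (that is, of \<open>S\<^sup>1 \<times> S\<^sup>1\<close>) with an
  unknotted torus in three-space. No particular identification is singled out; the
  standard one is an instance.\<close>

definition unknotted_torus_embedding :: "(complex \<times> complex \<Rightarrow> real ^ 3) \<Rightarrow> bool" where
  "unknotted_torus_embedding e \<longleftrightarrow>
     (\<exists>T f. unknotted_torus T \<and> homeomorphism (log_fiber 0) T e f)"

lemma unknotted_standard_torus: "unknotted_torus standard_torus"
  unfolding unknotted_torus_def ambient_isotopic_def
  by (rule exI[of _ snd])
    (auto intro!: continuous_intros exI[of _ "\<lambda>x. x"] simp: homeomorphism_def)

lemma inj_on_standard_torus_map: "inj_on standard_torus_map (sphere 0 1 \<times> sphere 0 1)"
proof (rule inj_onI, clarify)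
  fix z w z' w' :: complex
  assume n: "z \<in> sphere 0 1" "w \<in> sphere 0 1" "z' \<in> sphere 0 1" "w' \<in> sphere 0 1"
    and eq: "standard_torus_map (z, w) = standard_torus_map (z', w')"
  have e: "(2 + Re w) * Re z = (2 + Re w') * Re z'" "(2 + Re w) * Im z = (2 + Re w') * Im z'"
    "Im w = Im w'"
    using eq by (auto simp: standard_torus_map_def vec_eq_iff forall_3)
  have sq: "((2 + Re u) * Re v)\<^sup>2 + ((2 + Re u) * Im v)\<^sup>2 = (2 + Re u)\<^sup>2" if "cmod v = 1" for u v
    using that cmod_power2[of v] by (simp add: power_mult_distrib flip: distrib_left)
  have pos: "2 + Re u > 0" if "cmod u = 1" for u
    using that abs_Re_le_cmod[of u] by simp
  have "(2 + Re w)\<^sup>2 = (2 + Re w')\<^sup>2"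
    using sq[of z w] sq[of z' w'] n e by simp
  with pos[of w] pos[of w'] n have "2 + Re w = 2 + Re w'"
    by (simp add: power2_eq_iff_nonneg)
  with e pos[of w] n show "z = z' \<and> w = w'"
    by (auto simp: complex_eq_iff)
qed

lemma unknotted_torus_embedding_standard: "unknotted_torus_embedding standard_torus_map"
proof -
  have c: "continuous_on (sphere 0 1 \<times> sphere 0 1) standard_torus_map"
  proof -
    have "continuous_on (sphere 0 1 \<times> sphere 0 1) (\<lambda>p. standard_torus_map p $ i)" for i
      using exhaust_3[of i]
      by (elim disjE; simp add: standard_torus_map_def; intro continuous_intros)
    then have "continuous_on (sphere 0 1 \<times> sphere 0 1) (\<lambda>p. \<chi> i. standard_torus_map p $ i)"
      by (rule continuous_on_vec_lambda)
    then show ?thesis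
      by simp
  qed
  obtain f where "homeomorphism (sphere 0 1 \<times> sphere 0 1) standard_torus standard_torus_map f"
    using homeomorphism_compact[OF _ c _ inj_on_standard_torus_map]
    by (metis compact_Times compact_sphere standard_torus_def)
  then show ?thesis
    unfolding unknotted_torus_embedding_def log_fiber_0 using unknotted_standard_torus by blast
qed

end

theory Submission
  imports Defs
begin

text \<open>Put \<open>u = z\<^sup>a w\<^sup>c\<close> and \<open>v = z\<^sup>b w\<^sup>d\<close>. If \<open>\<bar>\<tau>\<bar> > 1\<close>, then on the torus the curve is the graph
  \<open>v = - (1 + \<tau>u) / (\<tau> + u)\<close>, and since \<open>1 + u/\<tau>\<close> has positive real part, this reads
  \<open>v/u = - exp (- 2i\<beta>(u))\<close> with the continuous phase \<open>\<beta>(u) = arg (1 + u/\<tau>)\<close>. Rotating the point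
  \<open>(z, w)\<close> by \<open>\<beta>(u)\<close> times a suitable vector preserves \<open>u\<close> and straightens the fiber to the subgroup
  coset \<open>z\<^bsup>b-a\<^esup> w\<^bsup>d-c\<^esup> = -1\<close>, which a unimodular change of coordinates turns into
  \<open>gcd (b-a) (d-c)\<close> parallel circles. On the torus, the substitution
  \<open>(b, d, \<tau>) \<mapsto> (- b, - d, 1/\<tau>)\<close> reduces the case \<open>\<bar>\<tau>\<bar> < 1\<close> to this one.\<close>

section \<open>Finite families of circles\<close>

text \<open>\<open>is_link\<close> speaks of an abstract disjoint sum, whereas the fiber will be
  found as a product. The two agree because a finite set in a T1 space is discrete, so that the
  slices of the product are open.\<close>

lemma sum_topology_const_homeomorphic_Times:
  fixes R :: "'a :: t1_space set" and C :: "'b :: topological_space set"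
  assumes "finite R"
  shows "sum_topology (\<lambda>_. top_of_set C) {..<card R} homeomorphic_space top_of_set (R \<times> C)"
proof -
  obtain r where r: "bij_betw r {..<card R} R"
    using assms by (metis bij_betw_from_nat_into_finite)
  then have inj: "inj_on r {..<card R}" and img: "r ` {..<card R} = R"
    by (auto simp: bij_betw_def)
  let ?S = "sum_topology (\<lambda>_. top_of_set C) {..<card R}"
  let ?f = "\<lambda>(i, x). (r i, x)"
  have cont: "continuous_map ?S (top_of_set (R \<times> C)) ?f"
    unfolding continuous_map_def
  proof (intro conjI allI impI)
    show "?f \<in> topspace ?S \<rightarrow> topspace (top_of_set (R \<times> C))"
      using img by auto
    fix U assume U: "openin (top_of_set (R \<times> C)) U"
    have "openin (top_of_set C) {x \<in> C. (r i, x) \<in> U}" if "i < card R" for i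
    proof -
      have "openin (top_of_set C) (C \<inter> Pair (r i) -` U)"
      proof (rule continuous_openin_preimage[OF _ _ U])
        show "continuous_on C (Pair (r i))" by (intro continuous_intros)
        show "Pair (r i) \<in> C \<rightarrow> R \<times> C" using img that by auto
      qed
      then show ?thesis by (simp add: vimage_def Int_def)
    qed
    then show "openin ?S {x \<in> topspace ?S. ?f x \<in> U}"
      by (auto simp: openin_sum_topology)
  qed
  have "open_map ?S (top_of_set (R \<times> C)) ?f"
    unfolding open_map_def
  proof (intro allI impI)
    fix W assume "openin ?S W"
    then obtain U where W: "W = Sigma {..<card R} U"
      and U: "\<And>i. i < card R \<Longrightarrow> openin (top_of_set C) (U i)"
      by (auto simp: openin_sum_topology_alt)
    have "?f ` W = (\<Union>i<card R. {r i} \<times> U i)"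
      unfolding W by force
    moreover have "openin (top_of_set (R \<times> C)) ({r i} \<times> U i)" if "i < card R" for i
    proof (rule openin_Times)
      \<comment> \<open>The complement of a point in \<open>R\<close> is finite, hence
        closed.\<close>
      have "closedin (top_of_set R) (R - {r i})"
        using assms by (intro closed_subset finite_imp_closed) auto
      then show "openin (top_of_set R) {r i}"
        using that img by (simp add: openin_closedin_eq) blast
    qed (use U that in auto)
    ultimately show "openin (top_of_set (R \<times> C)) (?f ` W)"
      by (auto intro!: openin_Union)
  qed
  moreover have "?f ` topspace ?S = topspace (top_of_set (R \<times> C))"
    using img by force
  moreover have "inj_on ?f (topspace ?S)"
    using inj by (auto simp: inj_on_def)
  ultimately have "homeomorphic_map ?S (top_of_set (R \<times> C)) ?f"
    using cont by (intro bijective_open_imp_homeomorphic_map) auto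
  then show ?thesis
    by (rule homeomorphic_map_imp_homeomorphic_space)
qed

context
  fixes R :: "'a :: real_normed_algebra_1 set" and C :: "'b :: topological_space set"
    and S :: "'c :: topological_space set"
  assumes fin: "finite R" and conn: "connected C" and ne: "C \<noteq> {}"
    and hom: "S homeomorphic R \<times> C"
begin

text \<open>The image of a slice is connected. Conversely, the first coordinate of the inverse map
  is continuous with finitely many values, hence constant on every connected subset of
  \<open>S\<close>, so no component is larger than one such image.\<close>

lemma components_finite_Times:
  obtains h where "\<And>r. r \<in> R \<Longrightarrow> h ` ({r} \<times> C) homeomorphic C"
    and "components S = (\<lambda>r. h ` ({r} \<times> C)) ` R" and "inj_on (\<lambda>r. h ` ({r} \<times> C)) R"
proof -
  from hom obtain k h where hk: "homeomorphism (R \<times> C) S h k"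
    by (meson homeomorphic_def homeomorphism_symD)
  have hC: "homeomorphism ({r} \<times> C) (h ` ({r} \<times> C)) h k" if "r \<in> R" for r
    by (rule homeomorphism_of_subsets[OF hk]) (use that hk in \<open>auto simp: homeomorphism_def\<close>)
  have "{r} \<times> C homeomorphic C" for r :: 'a
    unfolding homeomorphic_minimal
    by (rule exI[of _ snd], rule exI[of _ "Pair r"]) (auto intro!: continuous_intros)
  then have circ: "h ` ({r} \<times> C) homeomorphic C" if "r \<in> R" for r
    using hC[OF that] by (meson homeomorphic_def homeomorphic_sym homeomorphic_trans)
  have comp: "connected_component_set S (h (r, x)) = h ` ({r} \<times> C)" if "r \<in> R" "x \<in> C" for r x
  proof
    have "connected (h ` ({r} \<times> C))"
      using circ[OF that(1)] conn homeomorphic_connectedness by blast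
    then show "h ` ({r} \<times> C) \<subseteq> connected_component_set S (h (r, x))"
      using that hk by (intro connected_component_maximal) (auto simp: homeomorphism_def)
    let ?K = "connected_component_set S (h (r, x))"
    have sub: "?K \<subseteq> S" by (rule connected_component_subset)
    have kS: "k y \<in> R \<times> C" "h (k y) = y" if "y \<in> S" for y
      using hk that by (auto simp: homeomorphism_def)
    have "continuous_on ?K (\<lambda>y. fst (k y))"
      using continuous_on_subset[OF homeomorphism_cont2[OF hk] sub] by (rule continuous_on_fst)
    moreover have "finite ((\<lambda>y. fst (k y)) ` ?K)"
      by (rule finite_subset[OF _ fin]) (use sub kS in force)
    ultimately have "(\<lambda>y. fst (k y)) constant_on ?K"
      by (intro continuous_finite_range_constant) auto
    moreover have "h (r, x) \<in> S" and "k (h (r, x)) = (r, x)"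
      using hk that by (auto simp: homeomorphism_def)
    ultimately have "fst (k y) = r" if "y \<in> ?K" for y
      using that unfolding constant_on_def by (metis connected_component_refl fst_conv mem_Collect_eq)
    then have "k y \<in> {r} \<times> C \<and> y = h (k y)" if "y \<in> ?K" for y
      using that kS sub by (metis insertI1 mem_Times_iff subset_iff)
    then show "?K \<subseteq> h ` ({r} \<times> C)"
      by blast
  qed
  have S: "S = h ` (R \<times> C)"
    using hk by (auto simp: homeomorphism_def)
  have "components S = (\<lambda>r. h ` ({r} \<times> C)) ` R"
  proof -
    have "components S = (\<lambda>p. connected_component_set S (h p)) ` (R \<times> C)"
      unfolding components_def by (subst (2) S) (simp add: image_image)
    also have "\<dots> = (\<lambda>p. h ` ({fst p} \<times> C)) ` (R \<times> C)"
      using comp by (intro image_cong refl) (metis mem_Times_iff prod.collapse)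
    also have "\<dots> = (\<lambda>r. h ` ({r} \<times> C)) ` fst ` (R \<times> C)"
      by (simp only: image_image)
    finally show ?thesis using ne by simp
  qed
  moreover have "inj_on (\<lambda>r. h ` ({r} \<times> C)) R"
  proof (rule inj_onI)
    fix r r' assume "r \<in> R" "r' \<in> R" and eq: "h ` ({r} \<times> C) = h ` ({r'} \<times> C)"
    obtain x where "x \<in> C" using ne by auto
    then obtain x' where "x' \<in> C" "h (r, x) = h (r', x')"
      using eq by blast
    then show "r = r'"
      using hk \<open>x \<in> C\<close> \<open>r \<in> R\<close> \<open>r' \<in> R\<close>
      by (metis SigmaI fst_conv homeomorphism_apply1)
  qed
  ultimately show thesis using that circ by blast
qed

lemma finite_components_finite_Times: "finite (components S)"
  by (rule components_finite_Times) (simp add: fin)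

lemma card_components_finite_Times: "card (components S) = card R"
  by (rule components_finite_Times) (simp add: card_image)

lemma component_homeomorphic_finite_Times: "K \<in> components S \<Longrightarrow> K homeomorphic C"
  by (rule components_finite_Times) auto

end

section \<open>Links made of finitely many circles on an unknotted torus\<close>

lemma homeomorphism_imp_homeomorphic_maps:
  "homeomorphism S T f g \<Longrightarrow> homeomorphic_maps (top_of_set S) (top_of_set T) f g"
  by (force simp: Pi_iff homeomorphic_maps_def homeomorphism_def)

text \<open>Torus knots and torus links are defined by their homeomorphism type and by lying on an
  unknotted torus. The product structure gives the former and \<open>T\<close> serves as the torus
  for the link and for all its components.\<close>

lemma link_of_torus_knots_finite_circles:
  fixes R :: "complex set"
  assumes "finite R" and "S homeomorphic R \<times> sphere (0 :: complex) 1"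
    and "unknotted_torus T" and "S \<subseteq> T"
  shows "link_of_torus_knots (card R) S"
proof -
  have C: "connected (sphere (0 :: complex) 1)" "sphere (0 :: complex) 1 \<noteq> {}"
    by (auto intro: connected_sphere)
  have "top_of_set S homeomorphic_space top_of_set (R \<times> sphere (0 :: complex) 1)"
    using assms(2) homeomorphism_imp_homeomorphic_maps
    unfolding homeomorphic_def homeomorphic_space_def by blast
  then have "is_link S"
    unfolding is_link_def
    using sum_topology_const_homeomorphic_Times[OF assms(1)] homeomorphic_space_sym
      homeomorphic_space_trans by blast
  then have "torus_link S"
    using assms(3,4) by (auto simp: torus_link_def)
  moreover have "torus_knot K" if "K \<in> components S" for K
  proof -
    have "K \<subseteq> T"
      using in_components_subset[OF that] assms(4) by simp
    then show ?thesis
      using component_homeomorphic_finite_Times[OF assms(1) C assms(2) that] assms(3)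
      by (auto simp: torus_knot_def is_knot_def)
  qed
  ultimately show ?thesis
    using finite_components_finite_Times[OF assms(1) C assms(2)]
      card_components_finite_Times[OF assms(1) C assms(2)]
    by (simp add: link_of_torus_knots_def)
qed

section \<open>Characters of the torus\<close>

definition torus_char :: "int \<Rightarrow> int \<Rightarrow> complex \<times> complex \<Rightarrow> complex" where
  "torus_char m n x = fst x powi m * snd x powi n"

abbreviation unit_torus :: "(complex \<times> complex) set" where
  "unit_torus \<equiv> sphere 0 1 \<times> sphere 0 1"

lemma unit_torus_nonzero: "x \<in> unit_torus \<Longrightarrow> fst x \<noteq> 0 \<and> snd x \<noteq> 0"
  by auto

lemma norm_torus_char [simp]: "x \<in> unit_torus \<Longrightarrow> cmod (torus_char m n x) = 1"
  by (auto simp: torus_char_def norm_mult norm_power_int)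

lemma continuous_on_torus_char [continuous_intros]:
  "continuous_on unit_torus (torus_char m n)"
  unfolding torus_char_def by (intro continuous_intros) auto

lemma torus_char_add:
  "x \<in> unit_torus \<Longrightarrow> torus_char (m + m') (n + n') x = torus_char m n x * torus_char m' n' x"
  using unit_torus_nonzero[of x] by (simp add: torus_char_def power_int_add)

lemma torus_char_diff:
  "x \<in> unit_torus \<Longrightarrow> torus_char (m - m') (n - n') x = torus_char m n x / torus_char m' n' x"
  using unit_torus_nonzero[of x] by (simp add: torus_char_def power_int_diff)

lemma torus_char_Pair_torus_char:
  assumes "x \<in> unit_torus"
  shows "torus_char i j (torus_char m n x, torus_char m' n' x) =
    torus_char (m * i + m' * j) (n * i + n' * j) x"
  using unit_torus_nonzero[OF assms]
  by (simp add: torus_char_def power_int_mult_distrib power_int_add power_int_mult)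

lemma torus_char_mult_power:
  "torus_char (int k * m) (int k * n) x = torus_char m n x ^ k"
  by (simp add: torus_char_def power_mult_distrib power_int_mult mult.commute[of "int k"])

lemma torus_char_cis:
  "torus_char m n (fst x * cis s, snd x * cis t) =
    torus_char m n x * cis (of_int m * s + of_int n * t)"
  by (simp add: torus_char_def power_int_mult_distrib cis_power_int cis_mult)

text \<open>Monomial maps compose by multiplying their exponent matrices. The matrix with rows
  \<open>(p, q)\<close> and \<open>(r, t)\<close> has determinant 1, so its adjugate is an integer
  inverse.\<close>

lemma torus_automorphism:
  assumes "p * t - q * r = 1"
  shows "homeomorphism unit_torus unit_torus
    (\<lambda>x. (torus_char p q x, torus_char r t x)) (\<lambda>x. (torus_char t (- q) x, torus_char (- r) p x))"
proof
  let ?F = "\<lambda>m n m' n' x. (torus_char m n x, torus_char m' n' x)"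
  have pair: "continuous_on unit_torus (?F m n m' n')" "?F m n m' n' ` unit_torus \<subseteq> unit_torus"
    for m n m' n'
    by (auto intro!: continuous_intros)
  show "continuous_on unit_torus (?F p q r t)" "continuous_on unit_torus (?F t (- q) (- r) p)"
    "?F p q r t ` unit_torus \<subseteq> unit_torus" "?F t (- q) (- r) p ` unit_torus \<subseteq> unit_torus"
    by (rule pair)+
  have "t * p - r * q = 1" "p * t - r * q = 1" "t * p - q * r = 1"
    using assms by (simp_all add: mult.commute)
  then show "?F t (- q) (- r) p (?F p q r t x) = x" "?F p q r t (?F t (- q) (- r) p x) = x"
    if "x \<in> unit_torus" for x
    using that assms
    by (simp_all only: torus_char_Pair_torus_char) (simp_all add: torus_char_def mult.commute)
qed

text \<open>Write \<open>(m, n)\<close> as its gcd \<open>s\<close> times a primitive vector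
  \<open>(p, q)\<close> and complete that vector to a unimodular matrix. In the new coordinates the
  character is the \<open>s\<close>-th power of the first coordinate, while the second one runs
  freely over the circle.\<close>

lemma torus_char_level_homeomorphic:
  assumes "(m, n) \<noteq> (0, 0)"
  shows "unit_torus \<inter> {x. torus_char m n x = - 1} homeomorphic
    {\<xi> :: complex. \<xi> ^ nat (gcd m n) = - 1} \<times> sphere (0 :: complex) 1"
proof -
  define s where "s = nat (gcd m n)"
  have s: "int s = gcd m n" "s > 0"
    using assms by (auto simp: s_def)
  obtain p q where pq: "m = int s * p" "n = int s * q" "coprime p q"
    using assms gcd_coprime_exists[of m n] s by (metis gcd_eq_0_iff mult.commute prod.inject)
  \<comment> \<open>Bezout coefficients of \<open>p\<close> and \<open>q\<close> supply the second
    row.\<close>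
  obtain t r where "p * t - q * r = 1"
    using bezout_int[of p q] pq(3)
    by (metis coprime_iff_gcd_eq_1 diff_minus_eq_add minus_mult_right mult.commute)
  note aut = torus_automorphism[OF this]
  let ?f = "\<lambda>x. (torus_char p q x, torus_char r t x)"
  let ?A = "unit_torus \<inter> {x. torus_char m n x = - 1}"
  have img: "?f ` unit_torus = unit_torus"
    using aut by (simp add: homeomorphism_def)
  have pow: "torus_char m n x = fst (?f x) ^ s" for x
    by (simp add: pq torus_char_mult_power)
  \<comment> \<open>All complex roots of -1 lie on the unit circle, so the torus misses none of
    them.\<close>
  have unit: "cmod \<xi> = 1" if "\<xi> ^ s = - 1" for \<xi> :: complex
  proof -
    have "cmod \<xi> ^ s = 1 ^ s"
      unfolding norm_power[symmetric] that by simp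
    then show ?thesis
      using s(2) by (simp add: power_eq_iff_eq_base del: power_one)
  qed
  have "?f ` ?A = {\<xi> :: complex. \<xi> ^ s = - 1} \<times> sphere 0 1"
  proof
    show "?f ` ?A \<subseteq> {\<xi> :: complex. \<xi> ^ s = - 1} \<times> sphere 0 1"
      using pow by auto
    show "{\<xi> :: complex. \<xi> ^ s = - 1} \<times> sphere 0 1 \<subseteq> ?f ` ?A"
    proof
      fix y assume y: "y \<in> {\<xi> :: complex. \<xi> ^ s = - 1} \<times> sphere (0 :: complex) 1"
      then have "y \<in> ?f ` unit_torus"
        unfolding img using unit by auto
      then obtain x where "x \<in> unit_torus" "y = ?f x" by blast
      with y pow[of x] show "y \<in> ?f ` ?A" by auto
    qed
  qed
  then have "homeomorphism ?A ({\<xi> :: complex. \<xi> ^ s = - 1} \<times> sphere 0 1) ?f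
     (\<lambda>x. (torus_char t (- q) x, torus_char (- r) p x))"
    by (intro homeomorphism_of_subsets[OF aut]) auto
  then show ?thesis
    unfolding s_def homeomorphic_def by blast
qed

text \<open>The rotation direction \<open>(v, v')\<close> is orthogonal to \<open>(m, n)\<close>, so
  \<open>torus_char m n\<close> is preserved. The angle is therefore the same at a point and at its
  image, and the opposite rotation is the inverse.\<close>

lemma torus_shear:
  fixes \<phi> :: "complex \<Rightarrow> real" and v v' :: real
  assumes "continuous_on (sphere 0 1) \<phi>" and "of_int m * v + of_int n * v' = 0"
  shows "homeomorphism unit_torus unit_torus
    (\<lambda>x. (fst x * cis (v * \<phi> (torus_char m n x)), snd x * cis (v' * \<phi> (torus_char m n x))))
    (\<lambda>x. (fst x * cis (- v * \<phi> (torus_char m n x)), snd x * cis (- v' * \<phi> (torus_char m n x))))"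
    (is "homeomorphism _ _ ?f ?g")
proof -
  have c: "continuous_on unit_torus (\<lambda>x. \<phi> (torus_char m n x))"
    by (rule continuous_on_compose2[OF assms(1)]) (auto intro!: continuous_intros)
  have inv: "torus_char m n (fst x * cis (w * y), snd x * cis (w' * y)) = torus_char m n x"
    if "x \<in> unit_torus" "of_int m * w + of_int n * w' = 0" for x w w' y
  proof -
    have "of_int m * (w * y) + of_int n * (w' * y) = (of_int m * w + of_int n * w') * y"
      by (simp add: algebra_simps)
    then show ?thesis
      using that by (simp add: torus_char_cis)
  qed
  show ?thesis
  proof
    show "continuous_on unit_torus ?f" "continuous_on unit_torus ?g"
      using c by (auto intro!: continuous_intros)
    show "?f ` unit_torus \<subseteq> unit_torus" "?g ` unit_torus \<subseteq> unit_torus"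
      by (auto simp: norm_mult)
    show "?g (?f x) = x" if "x \<in> unit_torus" for x
      using inv[OF that assms(2)] by (simp add: cis_mult mult.assoc)
    show "?f (?g x) = x" if "x \<in> unit_torus" for x
      using inv[OF that, of "- v" "- v'"] assms(2) by (simp add: cis_mult mult.assoc)
  qed
qed

section \<open>The fiber of the curve over the origin\<close>

lemma curve_fiber_eq:
  "curve_L a b c d \<tau> \<inter> log_fiber 0 = unit_torus \<inter>
     {x. 1 + of_real \<tau> * torus_char a c x + of_real \<tau> * torus_char b d x
       + torus_char (a + b) (c + d) x = 0}"
  unfolding log_fiber_0 curve_L_eq torus_char_def by (auto simp: mult.assoc)

text \<open>Divide the equation by \<tau> times \<open>torus_char b d x\<close>: this permutes the
  four terms and inverts both the parameter and the second character. The two diagonals of the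
  Newton polygon thereby exchange their roles.\<close>

lemma curve_fiber_inverse:
  assumes "\<tau> \<noteq> 0"
  shows "curve_L a b c d \<tau> \<inter> log_fiber 0 = curve_L a (- b) c (- d) (1 / \<tau>) \<inter> log_fiber 0"
proof -
  have "(1 + of_real \<tau> * torus_char a c x + of_real \<tau> * torus_char b d x
       + torus_char (a + b) (c + d) x = 0) \<longleftrightarrow>
     (1 + of_real (1 / \<tau>) * torus_char a c x + of_real (1 / \<tau>) * torus_char (- b) (- d) x
       + torus_char (a + - b) (c + - d) x = 0)" if x: "x \<in> unit_torus" for x
  proof -
    have nz: "torus_char b d x \<noteq> 0"
      using norm_torus_char[OF x] by (metis norm_zero zero_neq_one)
    have "torus_char (0 - b) (0 - d) x = 1 / torus_char b d x"
      using torus_char_diff[OF x, of 0 b 0 d] by (simp add: torus_char_def)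
    then show ?thesis
      using assms nz x by (simp add: torus_char_add torus_char_diff field_simps)
  qed
  then show ?thesis
    unfolding curve_fiber_eq by blast
qed

text \<open>The fiber is a level set of \<open>torus_char (b - a) (d - c)\<close> twisted by a phase
  that depends on \<open>torus_char a c\<close> alone. A shear preserving the latter character
  absorbs the phase.\<close>

lemma curve_fiber_homeomorphic:
  assumes D: "a * d - b * c \<noteq> 0" and \<tau>: "\<bar>\<tau>\<bar> > 1"
  shows "curve_L a b c d \<tau> \<inter> log_fiber 0 homeomorphic
    {\<xi> :: complex. \<xi> ^ nat (gcd (b - a) (d - c)) = - 1} \<times> sphere (0 :: complex) 1"
proof -
  define W where "W u = 1 + u / of_real \<tau>" for u :: complex
  define \<beta> where "\<beta> u = Im (Ln (W u))" for u
  have W_pos: "Re (W u) > 0" if "cmod u = 1" for u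
  proof -
    have "\<bar>Re u\<bar> \<le> 1" using abs_Re_le_cmod[of u] that by simp
    then have "\<bar>Re u / \<tau>\<bar> < 1" using \<tau> by (simp add: abs_divide divide_less_eq)
    then have "- 1 < Re u / \<tau>" by linarith
    then show ?thesis by (simp add: W_def)
  qed
  \<comment> \<open>The right half-plane avoids the branch cut of \<open>Ln\<close>.\<close>
  have cont: "continuous_on (sphere 0 1) \<beta>"
    unfolding \<beta>_def
  proof (intro continuous_intros)
    show "continuous_on (sphere 0 1) W" using \<tau> unfolding W_def by (intro continuous_intros) auto
    show "W u \<notin> \<real>\<^sub>\<le>\<^sub>0" if "u \<in> sphere 0 1" for u
      using W_pos[of u] that by (auto simp: complex_nonpos_Reals_iff)
  qed
  \<comment> \<open>By the polar form, the quotient of \<open>W u\<close> by its conjugate has twice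
    the argument of \<open>W u\<close>; this is the source of the factor 2 in the rotation
    below.\<close>
  have W_cis: "cnj (W u) * cis (2 * \<beta> u) = W u" if "cmod u = 1" for u
  proof -
    have nz: "W u \<noteq> 0" using W_pos[OF that] by auto
    then have W: "W u = of_real (cmod (W u)) * cis (\<beta> u)"
      using rcis_cmod_Arg[of "W u"] unfolding \<beta>_def by (simp add: rcis_def Arg_eq_Im_Ln)
    then have "cnj (W u) = cnj (of_real (cmod (W u)) * cis (\<beta> u))"
      by (rule arg_cong)
    also have "\<dots> = of_real (cmod (W u)) * cis (- \<beta> u)"
      by (simp add: cis_cnj)
    finally have "cnj (W u) = of_real (cmod (W u)) * cis (- \<beta> u)" .
    then have "cnj (W u) * cis (2 * \<beta> u) = of_real (cmod (W u)) * cis (\<beta> u)"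
      by (simp add: mult.assoc cis_mult)
    also have "\<dots> = W u" by (rule W[symmetric])
    finally show ?thesis .
  qed
  \<comment> \<open>On the unit circle \<open>1 + \<tau> u = \<tau> u \<cdot> cnj (W u)\<close> and \<open>\<tau> + u = \<tau> \<cdot> W u\<close>, so the curve is
    \<open>v W(u) = - u cnj (W u)\<close>, and the phase of \<open>W u\<close> has the continuous branch \<open>\<beta>\<close>.\<close>
  have eq: "1 + of_real \<tau> * torus_char a c x + of_real \<tau> * torus_char b d x
       + torus_char (a + b) (c + d) x = 0 \<longleftrightarrow>
     torus_char (b - a) (d - c) x * cis (2 * \<beta> (torus_char a c x)) = - 1"
    if x: "x \<in> unit_torus" for x
  proof -
    define u where "u = torus_char a c x"
    define v where "v = torus_char b d x"
    have u: "cmod u = 1" using x by (simp add: u_def)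
    then have uc: "u * cnj u = 1" by (simp add: complex_norm_square[symmetric])
    have u0: "u \<noteq> 0" and W0: "cnj (W u) \<noteq> 0"
      using u W_pos[OF u] by auto
    have \<tau>0: "complex_of_real \<tau> \<noteq> 0" using \<tau> by auto
    have "1 + of_real \<tau> * u + of_real \<tau> * v + u * v = of_real \<tau> * (u * cnj (W u) + v * W u)"
      using uc \<tau>0 by (simp add: W_def field_simps)
    also have "u * cnj (W u) + v * W u = u * cnj (W u) * (1 + v / u * cis (2 * \<beta> u))"
      using W_cis[OF u] u0 by (simp add: algebra_simps)
    finally have "1 + of_real \<tau> * u + of_real \<tau> * v + u * v = 0 \<longleftrightarrow> 1 + v / u * cis (2 * \<beta> u) = 0"
      using \<tau>0 u0 W0 by simp
    also have "\<dots> \<longleftrightarrow> v / u * cis (2 * \<beta> u) = - 1"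
      by (metis add.commute add_eq_0_iff)
    finally show ?thesis
      using x by (simp add: u_def v_def torus_char_add torus_char_diff)
  qed
  define \<Delta> where "\<Delta> = real_of_int (a * d - b * c)"
  have \<Delta>: "\<Delta> \<noteq> 0" using D unfolding \<Delta>_def by (metis of_int_eq_0_iff)
  \<comment> \<open>This vector solves the linear system asking for inner product 0 with
    \<open>(a, c)\<close> and 2 with \<open>(b - a, d - c)\<close>: the rotation fixes
    \<open>torus_char a c\<close> and contributes exactly the phase in \<open>eq\<close>.\<close>
  let ?v = "- 2 * of_int c / \<Delta>" and ?v' = "2 * of_int a / \<Delta>"
  define f where
    "f x = (fst x * cis (?v * \<beta> (torus_char a c x)), snd x * cis (?v' * \<beta> (torus_char a c x)))" for x
  let ?X = "curve_L a b c d \<tau> \<inter> log_fiber 0"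
  let ?Y = "unit_torus \<inter> {x. torus_char (b - a) (d - c) x = - 1}"
  obtain g where shear: "homeomorphism unit_torus unit_torus f g"
    using torus_shear[OF cont, of a ?v c ?v'] unfolding f_def by (auto simp: algebra_simps)
  have sum: "of_int (b - a) * (?v * y) + of_int (d - c) * (?v' * y) = 2 * y" for y
  proof -
    have "of_int (b - a) * (?v * y) + of_int (d - c) * (?v' * y) = 2 * \<Delta> * y / \<Delta>"
      by (simp add: \<Delta>_def add_divide_distrib[symmetric] diff_divide_distrib[symmetric] algebra_simps)
    then show ?thesis using \<Delta> by simp
  qed
  have char: "torus_char (b - a) (d - c) (f x) =
      torus_char (b - a) (d - c) x * cis (2 * \<beta> (torus_char a c x))" for x
    unfolding f_def torus_char_cis sum ..
  have mem: "x \<in> ?X \<longleftrightarrow> f x \<in> ?Y" if "x \<in> unit_torus" for x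
  proof -
    have "f x \<in> unit_torus" using shear that by (metis homeomorphism_image1 image_eqI)
    then have "f x \<in> ?Y \<longleftrightarrow> torus_char (b - a) (d - c) (f x) = - 1" by blast
    moreover have "x \<in> ?X \<longleftrightarrow> torus_char (b - a) (d - c) (f x) = - 1"
      unfolding curve_fiber_eq char using eq[OF that] that by blast
    ultimately show ?thesis by blast
  qed
  have "f ` ?X = ?Y"
  proof
    show "f ` ?X \<subseteq> ?Y" using mem unfolding curve_fiber_eq by blast
    show "?Y \<subseteq> f ` ?X"
    proof
      fix y assume y: "y \<in> ?Y"
      then have "y \<in> f ` unit_torus"
        unfolding homeomorphism_image1[OF shear] by (rule IntD1)
      then obtain x where x: "y = f x" "x \<in> unit_torus" by (rule imageE)
      with y have "x \<in> ?X" by (simp only: mem)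
      with x(1) show "y \<in> f ` ?X" by (rule image_eqI)
    qed
  qed
  then have "homeomorphism ?X ?Y f g"
    by (intro homeomorphism_of_subsets[OF shear]) (auto simp: log_fiber_0)
  then have "?X homeomorphic ?Y" by (auto simp: homeomorphic_def)
  moreover have "(b - a, d - c) \<noteq> (0, 0)"
  proof
    assume "(b - a, d - c) = (0, 0)"
    then have "b = a" "d = c" by auto
    with D show False by simp
  qed
  ultimately show ?thesis
    using torus_char_level_homeomorphic homeomorphic_trans by blast
qed

section \<open>Diagonals and integer lengths\<close>

text \<open>The lattice points of the segment are the multiples 0 to \<open>s\<close> of the
  primitive step \<open>(p, q)\<close> from one end, where \<open>s\<close> is the gcd. There are
  \<open>s + 1\<close> of them, and \<open>integer_length\<close> subtracts 1.\<close>

lemma integer_length_lattice_point: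
  "integer_length (lattice_point i j) (lattice_point k l) = nat (gcd (k - i) (l - j))"
proof (cases "k = i \<and> l = j")
  case True
  \<comment> \<open>A degenerate segment has one lattice point, which matches the value 0 of
    \<open>gcd 0 0\<close>.\<close>
  then have "{x. \<forall>i. x $ i \<in> \<int>} \<inter> closed_segment (lattice_point i j) (lattice_point k l)
      = {lattice_point i j}"
    by (auto simp: lattice_point_def forall_2)
  then show ?thesis using True by (simp add: integer_length_def)
next
  case False
  define s where "s = nat (gcd (k - i) (l - j))"
  have s: "int s = gcd (k - i) (l - j)" "s > 0"
    using False by (auto simp: s_def)
  obtain p q where pq: "k - i = int s * p" "l - j = int s * q" "coprime p q"
    using False gcd_coprime_exists[of "k - i" "l - j"] s
    by (metis eq_iff_diff_eq_0 gcd_eq_0_iff mult.commute)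
  then have kl: "k = i + int s * p" "l = j + int s * q" by auto
  let ?P = "\<lambda>n :: nat. lattice_point (i + int n * p) (j + int n * q)"
  let ?I = "{x. \<forall>i. x $ i \<in> \<int>} \<inter> closed_segment (lattice_point i j) (lattice_point k l)"
  have "p \<noteq> 0 \<or> q \<noteq> 0" using pq(3) by auto
  then have inj: "inj_on ?P {..s}"
    by (auto simp: inj_on_def lattice_point_def vec_eq_iff forall_2)
  have "?P ` {..s} = ?I"
  proof
    show "?P ` {..s} \<subseteq> ?I"
    proof clarify
      fix n assume "n \<le> s"
      have "?P n = (1 - real n / real s) *\<^sub>R lattice_point i j + (real n / real s) *\<^sub>R lattice_point k l"
        using s(2) by (simp add: lattice_point_def vec_eq_iff forall_2 kl field_simps)
      moreover have "0 \<le> real n / real s" "real n / real s \<le> 1"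
        using s(2) \<open>n \<le> s\<close> by auto
      ultimately have "?P n \<in> closed_segment (lattice_point i j) (lattice_point k l)"
        unfolding closed_segment_def by blast
      then show "?P n \<in> ?I" by (simp add: lattice_point_def forall_2)
    qed
    show "?I \<subseteq> ?P ` {..s}"
    proof
      fix x assume x: "x \<in> ?I"
      then obtain t where t: "0 \<le> t" "t \<le> 1"
        and xt: "x = (1 - t) *\<^sub>R lattice_point i j + t *\<^sub>R lattice_point k l"
        by (auto simp: closed_segment_def)
      have x1: "x $ 1 = of_int i + t * real s * of_int p"
        and x2: "x $ 2 = of_int j + t * real s * of_int q"
        unfolding xt by (simp_all add: lattice_point_def kl algebra_simps)
      have "x $ 1 \<in> \<int>" "x $ 2 \<in> \<int>" using x by auto
      then have tp: "t * real s * of_int p \<in> \<int>" "t * real s * of_int q \<in> \<int>"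
        by (metis Ints_diff Ints_of_int add_diff_cancel_left' x1 x2)+
      \<comment> \<open>If a real multiple of a primitive vector is integral, then so is the factor:
        the Bezout combination of the two coordinates recovers \<open>t * real s\<close>.\<close>
      obtain u v where "u * p + v * q = 1"
        using bezout_int[of p q] pq(3) by (metis coprime_iff_gcd_eq_1)
      then have "real_of_int u * of_int p + of_int v * of_int q = 1"
        by (metis of_int_1 of_int_add of_int_mult)
      then have "t * real s = of_int u * (t * real s * of_int p) + of_int v * (t * real s * of_int q)"
        by algebra
      also have "\<dots> \<in> \<int>" using tp by (metis Ints_add Ints_mult Ints_of_int)
      finally obtain n where n: "t * real s = of_int n" by (auto elim: Ints_cases)
      have "0 \<le> t * real s" "t * real s \<le> real s"
        using t s(2) by (auto simp: mult_left_le_one_le)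
      then have "0 \<le> n" "n \<le> int s" unfolding n by linarith+
      then have "x = ?P (nat n)" "nat n \<le> s"
        using x1 x2 n by (auto simp: lattice_point_def vec_eq_iff forall_2)
      then show "x \<in> ?P ` {..s}" by blast
    qed
  qed
  then have "card ?I = s + 1"
    using card_image[OF inj] by simp
  then show ?thesis by (simp add: integer_length_def s_def)
qed

text \<open>The other points lie in an open half-space that misses \<open>A\<close>, and so does
  their convex hull. Adjoining a point outside a hull makes it a vertex.\<close>

lemma extreme_point_of_convex_hull_separated:
  fixes f :: "'a :: euclidean_space \<Rightarrow> real"
  assumes "finite S" "A \<in> S" "linear f" and "\<And>x. x \<in> S - {A} \<Longrightarrow> f x < f A"
  shows "A extreme_point_of (convex hull S)"
proof -
  have "convex hull (S - {A}) \<subseteq> {x. f x < f A}"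
  proof (rule hull_minimal)
    show "S - {A} \<subseteq> {x. f x < f A}" using assms(4) by auto
    have "{x. f x < f A} = f -` {..<f A}" by auto
    then show "convex {x. f x < f A}"
      using assms(3) by (simp add: convex_linear_vimage)
  qed
  then have "A extreme_point_of (convex hull (insert A (S - {A})))"
    using assms(1) by (intro extreme_point_of_convex_hull_insert) auto
  then show ?thesis
    using assms(2) by (simp add: insert_absorb)
qed

text \<open>The two segments share their midpoint. A face containing an inner point of the segment
  from \<open>A'\<close> to \<open>B'\<close> must contain \<open>A'\<close> as well.\<close>

lemma crossing_segment_not_edge:
  fixes P :: "'a :: euclidean_space set"
  assumes "A + B = A' + B'" and "A' \<in> P" "B' \<in> P" and "A' \<notin> closed_segment A B"
  shows "\<not> closed_segment A B edge_of P"
proof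
  assume "closed_segment A B edge_of P"
  then have face: "closed_segment A B face_of P" by (simp add: edge_of_def)
  \<comment> \<open>This keeps the open segment nonempty, so that the midpoint is interior to
    it.\<close>
  have "A' \<noteq> B'"
  proof
    assume "A' = B'"
    with assms(1) have "midpoint A B = A'"
      by (simp add: midpoint_def flip: scaleR_2)
    with assms(4) show False by (metis midpoint_in_closed_segment)
  qed
  then have "midpoint A' B' \<in> open_segment A' B'" by simp
  moreover have "midpoint A' B' \<in> closed_segment A B"
    using assms(1) by (metis midpoint_def midpoint_in_closed_segment)
  ultimately show False
    using face_ofD[OF face] assms by blast
qed

text \<open>\<open>f\<close> and \<open>g\<close> are the coordinates in the basis \<open>A\<close>,
  \<open>B\<close>. They turn the parallelogram into the unit square, where vertices can be
  separated by explicit functionals.\<close>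

context
  fixes A B :: "real ^ 2" and f g :: "real ^ 2 \<Rightarrow> real"
  assumes lin: "linear f" "linear g"
    and dual: "f A = 1" "f B = 0" "g A = 0" "g B = 1"
begin

lemma coordinates_vertex: "f 0 = 0" "g 0 = 0" "f (A + B) = 1" "g (A + B) = 1"
  using lin dual by (simp_all add: linear_0 linear_add)

lemma is_diagonal_parallelogram:
  "is_diagonal (convex hull {0, A, B, A + B}) A B"
  unfolding is_diagonal_def
proof (intro conjI)
  let ?P = "{0, A, B, A + B}"
  \<comment> \<open>On \<open>0\<close>, \<open>A\<close>, \<open>B\<close>, \<open>A + B\<close>
    the functional \<open>f - g\<close> takes the values 0, 1, -1, 0; its negative singles out
    \<open>B\<close>.\<close>
  show "A extreme_point_of convex hull ?P"
    by (rule extreme_point_of_convex_hull_separated[where f = "\<lambda>x. f x - g x"])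
      (use lin dual coordinates_vertex in \<open>auto intro: linear_compose_sub\<close>)
  show "B extreme_point_of convex hull ?P"
    by (rule extreme_point_of_convex_hull_separated[where f = "\<lambda>x. g x - f x"])
      (use lin dual coordinates_vertex in \<open>auto intro: linear_compose_sub\<close>)
  show "A \<noteq> B" using dual by auto
  have "0 \<notin> closed_segment A B"
  proof
    assume "0 \<in> closed_segment A B"
    then obtain t where "0 = (1 - t) *\<^sub>R A + t *\<^sub>R B" by (auto simp: closed_segment_def)
    then have "f 0 = f ((1 - t) *\<^sub>R A + t *\<^sub>R B)" "g 0 = g ((1 - t) *\<^sub>R A + t *\<^sub>R B)"
      by simp_all
    then have "f 0 = 1 - t" "g 0 = t"
      using lin dual by (simp_all add: linear_add linear_scale)
    with coordinates_vertex show False by simp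
  qed
  then show "\<not> closed_segment A B edge_of convex hull ?P"
    by (intro crossing_segment_not_edge[where A' = 0 and B' = "A + B"]) (auto intro: hull_inc)
qed

lemma is_diagonal_parallelogram':
  "is_diagonal (convex hull {0, A, B, A + B}) 0 (A + B)"
  unfolding is_diagonal_def
proof (intro conjI)
  let ?P = "{0, A, B, A + B}"
  \<comment> \<open>Here \<open>f + g\<close> takes the values 0, 1, 1, 2, with unique minimum at
    \<open>0\<close> and unique maximum at \<open>A + B\<close>.\<close>
  show "0 extreme_point_of convex hull ?P"
    by (rule extreme_point_of_convex_hull_separated[where f = "\<lambda>x. - (f x + g x)"])
      (use lin dual coordinates_vertex in
        \<open>auto intro: linear_compose_neg linear_compose_add simp del: minus_add_distrib\<close>)
  show "(A + B) extreme_point_of convex hull ?P"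
    by (rule extreme_point_of_convex_hull_separated[where f = "\<lambda>x. f x + g x"])
      (use lin dual coordinates_vertex in \<open>auto intro: linear_compose_add\<close>)
  show "0 \<noteq> A + B" using coordinates_vertex by auto
  have "A \<notin> closed_segment 0 (A + B)"
  proof
    assume "A \<in> closed_segment 0 (A + B)"
    then obtain t where "A = t *\<^sub>R (A + B)" by (auto simp: closed_segment_def)
    then have "f A = g A"
      using lin coordinates_vertex by (metis linear_scale)
    with dual show False by simp
  qed
  then show "\<not> closed_segment 0 (A + B) edge_of convex hull ?P"
    by (intro crossing_segment_not_edge[where A' = A and B' = B]) (auto intro: hull_inc)
qed

end

lemma is_diagonal_newton_polygon:
  assumes "a * d - b * c \<noteq> 0" "\<tau> \<noteq> 0"
  defines "P \<equiv> newton_polygon (g_poly a b c d \<tau>)"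
  shows "is_diagonal P (lattice_point a c) (lattice_point b d)"
    and "is_diagonal P (lattice_point 0 0) (lattice_point (a + b) (c + d))"
proof -
  define \<Delta> where "\<Delta> = real_of_int (a * d - b * c)"
  have \<Delta>: "\<Delta> \<noteq> 0" using assms(1) unfolding \<Delta>_def by (metis of_int_eq_0_iff)
  \<comment> \<open>The rows of the inverse of the matrix with columns \<open>(a, c)\<close> and
    \<open>(b, d)\<close>.\<close>
  define f g :: "real ^ 2 \<Rightarrow> real"
    where "f x = (of_int d * x $ 1 - of_int b * x $ 2) / \<Delta>"
      and "g x = (of_int a * x $ 2 - of_int c * x $ 1) / \<Delta>" for x
  let ?A = "lattice_point a c" and ?B = "lattice_point b d"
  have lin: "linear f" "linear g"
    by (rule linearI; simp add: f_def g_def field_simps add_divide_distrib diff_divide_distrib)+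
  have dual: "f ?A = 1" "f ?B = 0" "g ?A = 0" "g ?B = 1"
    using \<Delta> by (simp_all add: f_def g_def lattice_point_def divide_eq_eq)
      (simp_all add: \<Delta>_def algebra_simps)
  have AB: "lattice_point (a + b) (c + d) = ?A + ?B" "lattice_point 0 0 = 0"
    by (simp_all add: lattice_point_def vec_eq_iff forall_2)
  have P: "P = convex hull {0, ?A, ?B, ?A + ?B}"
    unfolding P_def newton_polygon_g_poly[OF assms(1,2)] AB ..
  show "is_diagonal P ?A ?B"
    unfolding P by (rule is_diagonal_parallelogram[OF lin dual])
  show "is_diagonal P (lattice_point 0 0) (lattice_point (a + b) (c + d))"
    unfolding P AB by (rule is_diagonal_parallelogram'[OF lin dual])
qed

section \<open>Topology of the fiber\<close>

text \<open>Shared by both cases of the theorem: -1 has exactly \<open>s\<close> complex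
  \<open>s\<close>-th roots when \<open>s\<close> is positive, and each root carries one circle.
  Positivity of \<open>s\<close> also makes the fiber nonempty, which puts the origin in the
  amoeba.\<close>

lemma fiber_finite_circles:
  fixes m n :: int and X :: "(complex \<times> complex) set"
  assumes mn: "(m, n) \<noteq> (0, 0)" and X: "X \<subseteq> log_fiber 0"
    and hom: "X homeomorphic {\<xi> :: complex. \<xi> ^ nat (gcd m n) = - 1} \<times> sphere (0 :: complex) 1"
  shows "X \<noteq> {}" and "finite (components X)" and "card (components X) = nat (gcd m n)"
    and "unknotted_torus_embedding e \<Longrightarrow> link_of_torus_knots (nat (gcd m n)) (e ` X)"
proof -
  let ?R = "{\<xi> :: complex. \<xi> ^ nat (gcd m n) = - 1}"
  have pos: "nat (gcd m n) > 0" using mn by auto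
  then have card: "card ?R = nat (gcd m n)" by (intro card_nth_roots) auto
  \<comment> \<open>An infinite set has \<open>card\<close> 0, so positive cardinality forces
    finiteness.\<close>
  with pos have fin: "finite ?R" by (metis card.infinite less_irrefl)
  have C: "connected (sphere (0 :: complex) 1)" "sphere (0 :: complex) 1 \<noteq> {}"
    by (auto intro: connected_sphere)
  show "finite (components X)" and cc: "card (components X) = nat (gcd m n)"
    using finite_components_finite_Times[OF fin C hom] card_components_finite_Times[OF fin C hom] card
    by simp_all
  then show "X \<noteq> {}" using pos by (auto simp del: zero_less_nat_eq)
  assume "unknotted_torus_embedding e"
  then obtain T f where T: "unknotted_torus T" and e: "homeomorphism (log_fiber 0) T e f"
    unfolding unknotted_torus_embedding_def by blast
  have "homeomorphism X (e ` X) e f"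
    using homeomorphism_of_subsets[OF e X] by blast
  then have "e ` X homeomorphic X"
    using homeomorphism_symD unfolding homeomorphic_def by blast
  then have "e ` X homeomorphic ?R \<times> sphere (0 :: complex) 1"
    using hom by (rule homeomorphic_trans)
  moreover have "e ` X \<subseteq> T"
    using e X by (auto simp: homeomorphism_def)
  ultimately show "link_of_torus_knots (nat (gcd m n)) (e ` X)"
    using link_of_torus_knots_finite_circles[OF fin _ T, of "e ` X"] unfolding card by blast
qed

lemma origin_in_amoeba: "curve_L a b c d \<tau> \<inter> log_fiber 0 \<noteq> {} \<Longrightarrow> 0 \<in> amoeba (curve_L a b c d \<tau>)"
  unfolding amoeba_def log_fiber_def by force

theorem theorem4p5:
  fixes a b c d :: int and \<tau> :: real
  assumes "a * d - b * c \<noteq> 0"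
    and "\<tau> \<noteq> 0" and "\<tau> \<noteq> 1" and "\<tau> \<noteq> - 1"
  shows "0 \<in> amoeba (curve_L a b c d \<tau>) \<and>
    (let X = curve_L a b c d \<tau> \<inter> log_fiber 0; s = card (components X);
         P = newton_polygon (g_poly a b c d \<tau>)
     in finite (components X) \<and>
        (\<bar>\<tau>\<bar> > 1 \<longrightarrow>
           is_diagonal P (lattice_point a c) (lattice_point b d) \<and>
           s = integer_length (lattice_point a c) (lattice_point b d) \<and>
           int s = \<bar>gcd (b - a) (d - c)\<bar> \<and>
           (\<forall>e. unknotted_torus_embedding e \<longrightarrow> link_of_torus_knots s (e ` X))) \<and>
        (0 < \<bar>\<tau>\<bar> \<and> \<bar>\<tau>\<bar> < 1 \<longrightarrow>
           is_diagonal P (lattice_point 0 0) (lattice_point (a + b) (c + d)) \<and>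
           s = integer_length (lattice_point 0 0) (lattice_point (a + b) (c + d)) \<and>
           s = integer_length (lattice_point (a + b) 0) (lattice_point 0 (c + d)) \<and>
           int s = \<bar>gcd (b + a) (c + d)\<bar> \<and>
           (\<forall>e. unknotted_torus_embedding e \<longrightarrow> link_of_torus_knots s (e ` X))))"
proof -
  let ?X = "curve_L a b c d \<tau> \<inter> log_fiber 0"
  note diag = is_diagonal_newton_polygon[OF assms(1,2)]
  have mn: "(b - a, d - c) \<noteq> (0, 0)" "(a + b, c + d) \<noteq> (0, 0)"
  proof -
    show "(b - a, d - c) \<noteq> (0, 0)"
    proof
      assume "(b - a, d - c) = (0, 0)"
      then have "b = a" "d = c" by auto
      with assms(1) show False by simp
    qed
    show "(a + b, c + d) \<noteq> (0, 0)"
    proof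
      assume "(a + b, c + d) = (0, 0)"
      then have "b = - a" "d = - c" by auto
      with assms(1) show False by simp
    qed
  qed
  consider "\<bar>\<tau>\<bar> > 1" | "\<bar>\<tau>\<bar> < 1" using assms by linarith
  then show ?thesis
  proof cases
    case 1
    note X = fiber_finite_circles[OF mn(1) Int_lower2 curve_fiber_homeomorphic[OF assms(1) 1]]
    show ?thesis
      using 1 X origin_in_amoeba diag by (simp add: Let_def integer_length_lattice_point)
  next
    case 2
    have "a * - d - - b * c \<noteq> 0" "\<bar>1 / \<tau>\<bar> > 1" using assms 2 by (auto simp: abs_divide)
    \<comment> \<open>With \<open>- b\<close> and \<open>- d\<close> in place of \<open>b\<close>
      and \<open>d\<close>, the difference of exponent vectors becomes minus their sum, which leads
      to the second diagonal.\<close>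
    then have "?X homeomorphic
        {\<xi> :: complex. \<xi> ^ nat (gcd (- b - a) (- d - c)) = - 1} \<times> sphere (0 :: complex) 1"
      unfolding curve_fiber_inverse[OF assms(2)] by (rule curve_fiber_homeomorphic)
    moreover have "gcd (- b - a) (- d - c) = gcd (a + b) (c + d)"
    proof -
      have "gcd (- b - a) (- d - c) = gcd (- (a + b)) (- (c + d))"
        by (simp add: minus_diff_commute)
      also have "\<dots> = gcd (a + b) (c + d)" by (simp only: gcd_neg1_int gcd_neg2_int)
      finally show ?thesis .
    qed
    ultimately have hom: "?X homeomorphic
        {\<xi> :: complex. \<xi> ^ nat (gcd (a + b) (c + d)) = - 1} \<times> sphere (0 :: complex) 1"
      by simp
    note X = fiber_finite_circles[OF mn(2) Int_lower2 hom]
    \<comment> \<open>The segment from \<open>(a + b, 0)\<close> to \<open>(0, c + d)\<close>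
      differs in direction from the second diagonal by the sign of one coordinate, so both have the
      same integer length.\<close>
    have "gcd (0 - (a + b)) (c + d - 0) = gcd (a + b) (c + d)"
      by (metis diff_0 diff_zero gcd_neg1_int)
    then show ?thesis
      using 2 X origin_in_amoeba diag
      by (simp add: Let_def integer_length_lattice_point add.commute[of b a])
  qed
qed

end
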